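(* Let $N(n)$ denote God's Number of the $n\times n\times n$ Rubik's Cube, i.e. the smallest $k$ such that every valid configuration can be brought to the solved state by a sequence of at most $k$ basic moves. Then $N(n)=\Omega\!\left(n^2/\log n\right)$ as $n\to\infty$.
   Context: The $n\times n\times n$ Rubik's Cube has six faces, each an $n\times n$ grid of colored stickers; in the solved state each face is monochromatic with six distinct colors. It has $3n$ slices ($n\times n\times 1$ layers parallel to a face, $n$ for each of the three axes, including the central slices when $n$ is odd). A basic move is a $90^\circ$ rotation, clockwise or counterclockwise, of a single slice, giving $6n$ basic moves. A configuration is valid if it can be obtained from the solved state by a sequence of basic moves. *)

theory Defs
  imports Complex_Main "HOL-Library.Landau_Symbols"
begin

text \<open>
  The cube of side \<open>n\<close> is the solid \<open>[-n, n]\<^sup>3\<close>, in units of half a cubie edge and with its centre at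
  the origin.  Each cubie is a box of side 2, and a sticker is located at the midpoint of the cubie
  facet that carries it.  All sticker positions are then integer points: one coordinate is \<open>\<plusminus>n\<close> (which
  selects the face), and the other two lie in \<open>{-(n-1), -(n-3), \<dots>, n-1}\<close>.
\<close>

type_synonym point = "int \<times> int \<times> int"

definition cubie_coords :: "nat \<Rightarrow> int set" where
  "cubie_coords n = (\<lambda>i. 2 * int i + 1 - int n) ` {..<n}"

definition stickers :: "nat \<Rightarrow> point set" where
  "stickers n =
     (let L = cubie_coords n; B = {int n, - int n}
      in B \<times> L \<times> L \<union> L \<times> B \<times> L \<union> L \<times> L \<times> B)"

datatype color = White | Yellow | Red | Orange | Blue | Green

text \<open>A configuration is \<open>None\<close> exactly at the points that carry no sticker.\<close>

type_synonym config = "point \<Rightarrow> color option"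

definition solved :: "nat \<Rightarrow> config" where
  "solved n = (\<lambda>(x, y, z).
     if (x, y, z) \<notin> stickers n then None
     else if x = int n then Some Red
     else if x = - int n then Some Orange
     else if y = int n then Some Blue
     else if y = - int n then Some Green
     else if z = int n then Some White
     else Some Yellow)"

datatype axis = X_axis | Y_axis | Z_axis

datatype direction = Clockwise | Counterclockwise

fun coord :: "axis \<Rightarrow> point \<Rightarrow> int" where
  "coord X_axis (x, y, z) = x"
| "coord Y_axis (x, y, z) = y"
| "coord Z_axis (x, y, z) = z"

text \<open>Directions are those seen when looking from the positive end of the axis towards the origin.\<close>

fun rotate90 :: "axis \<Rightarrow> direction \<Rightarrow> point \<Rightarrow> point" where
  "rotate90 X_axis Counterclockwise (x, y, z) = (x, - z, y)"
| "rotate90 Y_axis Counterclockwise (x, y, z) = (z, y, - x)"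
| "rotate90 Z_axis Counterclockwise (x, y, z) = (- y, x, z)"
| "rotate90 X_axis Clockwise (x, y, z) = (x, z, - y)"
| "rotate90 Y_axis Clockwise (x, y, z) = (- z, y, x)"
| "rotate90 Z_axis Clockwise (x, y, z) = (y, - x, z)"

fun opposite :: "direction \<Rightarrow> direction" where
  "opposite Clockwise = Counterclockwise"
| "opposite Counterclockwise = Clockwise"

text \<open>
  The \<open>i\<close>-th slice is a closed slab of thickness 2.  A sticker lies on the bounding planes of a slab
  only if the slab is outermost and the sticker is on the corresponding face of the cube, so every
  sticker belongs to exactly one slice for each axis.
\<close>

definition slice :: "nat \<Rightarrow> axis \<Rightarrow> nat \<Rightarrow> point set" where
  "slice n a i = {p. 2 * int i - int n \<le> coord a p \<and> coord a p \<le> 2 * int i + 2 - int n}"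

datatype move = Turn axis nat direction

definition basic_moves :: "nat \<Rightarrow> move set" where
  "basic_moves n = {Turn a i d | a i d. i < n}"

text \<open>
  The sticker that ends up at \<open>p\<close> comes from the preimage of \<open>p\<close> under the rotation; hence \<open>opposite\<close>.
\<close>

fun apply_move :: "nat \<Rightarrow> move \<Rightarrow> config \<Rightarrow> config" where
  "apply_move n (Turn a i d) c =
     (\<lambda>p. if p \<in> slice n a i then c (rotate90 a (opposite d) p) else c p)"

definition apply_moves :: "nat \<Rightarrow> move list \<Rightarrow> config \<Rightarrow> config" where
  "apply_moves n ms c = fold (apply_move n) ms c"

definition valid :: "nat \<Rightarrow> config \<Rightarrow> bool" where
  "valid n c \<longleftrightarrow> (\<exists>ms. set ms \<subseteq> basic_moves n \<and> c = apply_moves n ms (solved n))"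

definition gods_number :: "nat \<Rightarrow> nat" where
  "gods_number n = (LEAST k. \<forall>c. valid n c \<longrightarrow>
     (\<exists>ms. set ms \<subseteq> basic_moves n \<and> length ms \<le> k \<and> apply_moves n ms c = solved n))"

end

theory Submission imports Defs begin

text \<open>
  Two permutations whose supports meet in a single point have a 3-cycle as their commutator.  The
  turn of an inner slice \<open>x = a\<close> and the turn of another inner slice \<open>x = b\<close>, conjugated by a turn of
  the top layer, meet only in the sticker \<open>(a, -b, n)\<close> of the top face, so the eight-move
  commutator replaces this white sticker by one from the face \<open>y = -n\<close> and leaves all other top
  stickers alone.  Letting \<open>(a, b)\<close> range over about \<open>n\<^sup>2/16\<close> pairs whose 3-cycles are disjoint, every
  subset of these top stickers can be made non-white, so there are at least \<open>2\<close> to the power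
  \<open>n\<^sup>2/64\<close> valid configurations.  At most \<open>(6n + 1)\<close> to the power \<open>k\<close> of them can be solved in
  \<open>k\<close> moves.
\<close>

section \<open>Moves as invertible maps on configurations\<close>

lemma apply_moves_Nil [simp]: "apply_moves n [] c = c"
  by (simp add: apply_moves_def)

lemma apply_moves_Cons [simp]:
  "apply_moves n (m # ms) c = apply_moves n ms (apply_move n m c)"
  by (simp add: apply_moves_def)

lemma apply_moves_append [simp]:
  "apply_moves n (ms @ ms') c = apply_moves n ms' (apply_moves n ms c)"
  by (simp add: apply_moves_def)

lemma coord_rotate90 [simp]: "coord a (rotate90 a d p) = coord a p"
  by (cases p; cases a; cases d) auto

lemma rotate90_opposite [simp]:
  "rotate90 a (opposite d) (rotate90 a d p) = p"
  "rotate90 a d (rotate90 a (opposite d) p) = p"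
  by (cases p; cases a; cases d; simp)+

lemma opposite_opposite [simp]: "opposite (opposite d) = d"
  by (cases d) auto

lemma rotate90_in_slice_iff [simp]: "rotate90 a d p \<in> slice n a i \<longleftrightarrow> p \<in> slice n a i"
  by (simp add: slice_def)

lemma apply_move_opposite [simp]:
  "apply_move n (Turn a i (opposite d)) (apply_move n (Turn a i d) c) = c"
  by (rule ext) simp

text \<open>Each move is undone by the opposite turn of the same slice. In the counting this makes a
  configuration recoverable from any list that solves it.\<close>

lemma inj_apply_moves: "inj (apply_moves n ms)"
proof (induction ms)
  case Nil
  then show ?case by (simp add: inj_def)
next
  case (Cons m ms)
  obtain a i d where m: "m = Turn a i d" by (cases m)
  have "inj (apply_move n m)"
    unfolding m by (rule inj_on_inverseI[where g = "apply_move n (Turn a i (opposite d))"])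
      (rule apply_move_opposite)
  with Cons have "inj (apply_moves n ms \<circ> apply_move n m)"
    by (simp only: inj_compose)
  then show ?case by (simp add: comp_def)
qed

lemma basic_move_opposite:
  "Turn a i d \<in> basic_moves n \<Longrightarrow> Turn a i (opposite d) \<in> basic_moves n"
  by (auto simp: basic_moves_def)

lemma apply_moves_invertible:
  assumes "set ms \<subseteq> basic_moves n"
  shows "\<exists>ms'. set ms' \<subseteq> basic_moves n \<and> (\<forall>c. apply_moves n ms' (apply_moves n ms c) = c)"
  using assms
proof (induction ms)
  case Nil
  then show ?case by (intro exI[of _ "[]"]) simp
next
  case (Cons m ms)
  then obtain ms' where ms': "set ms' \<subseteq> basic_moves n"
    "\<And>c. apply_moves n ms' (apply_moves n ms c) = c"
    by auto
  obtain a i d where m: "m = Turn a i d" by (cases m)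
  with Cons.prems have "Turn a i (opposite d) \<in> basic_moves n"
    using basic_move_opposite by simp
  with ms' show ?case
    by (intro exI[of _ "ms' @ [Turn a i (opposite d)]"])
       (simp add: m del: apply_move.simps)
qed

lemma basic_moves_eq:
  "basic_moves n = (\<lambda>(a, i, d). Turn a i d) `
     ({X_axis, Y_axis, Z_axis} \<times> {..<n} \<times> {Clockwise, Counterclockwise})"
proof -
  have "a \<in> {X_axis, Y_axis, Z_axis}" for a by (cases a) auto
  moreover have "d \<in> {Clockwise, Counterclockwise}" for d by (cases d) auto
  ultimately show ?thesis unfolding basic_moves_def by (auto simp: image_iff)
qed

lemma finite_basic_moves [simp]: "finite (basic_moves n)"
  by (simp add: basic_moves_eq)

lemma card_basic_moves: "card (basic_moves n) = 6 * n"
  unfolding basic_moves_eq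
  by (subst card_image) (auto simp: inj_on_def card_cartesian_product)

section \<open>Finiteness of the set of valid configurations\<close>

text \<open>A coarse finite superset of \<open>stickers n\<close> that suffices for finiteness; its
  invariance under quarter turns is immediate.\<close>

definition box :: "nat \<Rightarrow> point set" where
  "box n = {- int n..int n} \<times> {- int n..int n} \<times> {- int n..int n}"

lemma rotate90_in_box_iff [simp]: "rotate90 a d p \<in> box n \<longleftrightarrow> p \<in> box n"
  by (cases p; cases a; cases d) (auto simp: box_def)

lemma stickers_subset_box: "stickers n \<subseteq> box n"
  by (auto simp: stickers_def box_def cubie_coords_def Let_def)

lemma valid_outside_box:
  assumes "valid n c" "p \<notin> box n"
  shows "c p = None"
proof -
  have *: "apply_moves n ms c p = None" if "\<And>p. p \<notin> box n \<Longrightarrow> c p = None" for ms c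
    using that
  proof (induction ms arbitrary: c)
    case Nil
    then show ?case using assms(2) by simp
  next
    case (Cons m ms)
    show ?case
      by (cases m) (use Cons in simp)
  qed
  have "solved n q = None" if "q \<notin> box n" for q
    using that stickers_subset_box[of n] by (cases q) (auto simp: solved_def)
  then show ?thesis
    using assms(1) *[of "solved n"] unfolding valid_def by auto
qed

lemma finite_valid: "finite {c. valid n c}"
proof (rule finite_subset)
  show "{c. valid n c} \<subseteq> {c. \<forall>p. (p \<in> box n \<longrightarrow> c p \<in> UNIV) \<and> (p \<notin> box n \<longrightarrow> c p = None)}"
    using valid_outside_box by auto
  have "x \<in> {White, Yellow, Red, Orange, Blue, Green}" for x
    by (cases x) auto
  then have "(UNIV :: color option set)
      \<subseteq> insert None (Some ` {White, Yellow, Red, Orange, Blue, Green})"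
    by (metis image_eqI insertCI not_None_eq subsetI)
  then have "finite (UNIV :: color option set)"
    by (rule finite_subset) simp
  then show "finite {c. \<forall>p. (p \<in> box n \<longrightarrow> c p \<in> (UNIV :: color option set))
      \<and> (p \<notin> box n \<longrightarrow> c p = None)}"
    by (intro finite_set_of_finite_funs) (simp_all add: box_def)
qed

section \<open>Counting configurations by their solutions\<close>

lemma valid_solvable:
  assumes "valid n c"
  shows "\<exists>ms. set ms \<subseteq> basic_moves n \<and> apply_moves n ms c = solved n"
  using assms apply_moves_invertible unfolding valid_def by metis

text \<open>\<open>LEAST\<close> says nothing until some bound is known to work. Finiteness supplies
  one: the maximal length of one chosen solution per valid configuration.\<close>

lemma gods_number_solves:
  assumes "valid n c"
  shows "\<exists>ms. set ms \<subseteq> basic_moves n \<and> length ms \<le> gods_number n \<and> apply_moves n ms c = solved n"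
proof -
  obtain sol where sol: "\<And>c. valid n c \<Longrightarrow> set (sol c) \<subseteq> basic_moves n"
    "\<And>c. valid n c \<Longrightarrow> apply_moves n (sol c) c = solved n"
    using valid_solvable by metis
  define k where "k = Max ((length \<circ> sol) ` {c. valid n c})"
  have "length (sol c) \<le> k" if "valid n c" for c
    unfolding k_def using that finite_valid by (intro Max_ge) auto
  with sol have "\<forall>c. valid n c \<longrightarrow>
     (\<exists>ms. set ms \<subseteq> basic_moves n \<and> length ms \<le> k \<and> apply_moves n ms c = solved n)"
    by blast
  then have "\<forall>c. valid n c \<longrightarrow>
     (\<exists>ms. set ms \<subseteq> basic_moves n \<and> length ms \<le> gods_number n \<and> apply_moves n ms c = solved n)"
    unfolding gods_number_def by (rule LeastI)
  with assms show ?thesis by blast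
qed

text \<open>In terms of words: one extra padding letter turns every word of length at most
  \<open>k\<close> into a word of length exactly \<open>k\<close>.\<close>

lemma sum_power_le_Suc_power: "(\<Sum>i\<le>k. N ^ i) \<le> Suc N ^ k"
proof (induction k)
  case (Suc k)
  have "N ^ Suc k \<le> N * Suc N ^ k"
    unfolding power_Suc by (intro mult_left_mono power_mono) auto
  with add_mono[OF Suc this] show ?case
    by (simp only: sum.atMost_Suc power_Suc mult_Suc)
qed simp

lemma card_valid_le: "card {c. valid n c} \<le> (6 * n + 1) ^ gods_number n"
proof -
  let ?L = "{ms. set ms \<subseteq> basic_moves n \<and> length ms \<le> gods_number n}"
  obtain sol where sol: "\<And>c. valid n c \<Longrightarrow> sol c \<in> ?L"
    "\<And>c. valid n c \<Longrightarrow> apply_moves n (sol c) c = solved n"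
    using gods_number_solves by (metis (mono_tags, lifting) mem_Collect_eq)
  have "inj_on sol {c. valid n c}"
    using sol(2) inj_apply_moves by (intro inj_onI) (metis injD mem_Collect_eq)
  then have "card {c. valid n c} \<le> card ?L"
    using sol(1) by (intro card_inj_on_le) (auto simp: finite_lists_length_le)
  also have "\<dots> = (\<Sum>i\<le>gods_number n. (6 * n) ^ i)"
    by (simp add: card_lists_length_le card_basic_moves)
  also have "\<dots> \<le> (6 * n + 1) ^ gods_number n"
    using sum_power_le_Suc_power[where N = "6 * n"] by (simp only: Suc_eq_plus1)
  finally show ?thesis .
qed

section \<open>Commutators and their action on top and side stickers\<close>

definition layer :: "nat \<Rightarrow> nat \<Rightarrow> int" where
  "layer n i = 2 * int i + 1 - int n"

text \<open>The minus sign arises because a clockwise turn of the top layer carries the line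
  \<open>x = layer n j\<close> to \<open>y = - layer n j\<close>.\<close>

definition top_sticker :: "nat \<Rightarrow> nat \<times> nat \<Rightarrow> point" where
  "top_sticker n = (\<lambda>(i, j). (layer n i, - layer n j, int n))"

definition side_sticker :: "nat \<Rightarrow> nat \<times> nat \<Rightarrow> point" where
  "side_sticker n = (\<lambda>(i, j). (layer n j, - int n, layer n i))"

text \<open>In order of application this is Q, P, inverse of Q, inverse of P: Q is the conjugated
  turn of slice \<open>j\<close> (first three moves), P the turn of slice \<open>i\<close>.\<close>

definition commutator :: "nat \<Rightarrow> nat \<times> nat \<Rightarrow> move list" where
  "commutator n = (\<lambda>(i, j).
     [Turn Z_axis (n - 1) Counterclockwise, Turn X_axis j Clockwise, Turn Z_axis (n - 1) Clockwise,
      Turn X_axis i Counterclockwise,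
      Turn Z_axis (n - 1) Counterclockwise, Turn X_axis j Counterclockwise,
      Turn Z_axis (n - 1) Clockwise,
      Turn X_axis i Clockwise])"

text \<open>
  The two index ranges are disjoint and lie on one side of the centre, which makes the 3-cycles of
  different pairs disjoint.
\<close>

definition index_pairs :: "nat \<Rightarrow> (nat \<times> nat) set" where
  "index_pairs m = {1..m} \<times> {m + 1..2 * m}"

lemma commutator_basic_moves:
  "4 * m + 2 < n \<Longrightarrow> ij \<in> index_pairs m \<Longrightarrow> set (commutator n ij) \<subseteq> basic_moves n"
  by (auto simp: commutator_def index_pairs_def basic_moves_def)

text \<open>These are the only forms of coordinate met when the stickers are traced through a
  commutator, so slice membership becomes index arithmetic.\<close>

lemma in_slice_iff:
  assumes "i < n"
  shows "coord a p = layer n k \<Longrightarrow> p \<in> slice n a i \<longleftrightarrow> k = i"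
    and "coord a p = - layer n k \<Longrightarrow> p \<in> slice n a i \<longleftrightarrow> k + i + 1 = n"
    and "coord a p = int n \<Longrightarrow> p \<in> slice n a i \<longleftrightarrow> i + 1 = n"
    and "coord a p = - int n \<Longrightarrow> p \<in> slice n a i \<longleftrightarrow> i = 0"
  using assms by (auto simp: slice_def layer_def)

text \<open>
  Unlike the defining equation, these rules rewrite only fully applied moves, which keeps the
  simplifier from building a case tree over all eight moves.
\<close>

lemma apply_move_cases:
  "p \<in> slice n a i \<Longrightarrow> apply_move n (Turn a i d) c p = c (rotate90 a (opposite d) p)"
  "p \<notin> slice n a i \<Longrightarrow> apply_move n (Turn a i d) c p = c p"
  by simp_all

text \<open>Traced backwards from the last move, the two turns of slice \<open>i\<close> cancel,
  since in between the position is on the face \<open>y = -n\<close>, untouched by the conjugated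
  turn. The first three moves then lead back to the side sticker.\<close>

lemma commutator_top_sticker:
  assumes "4 * m + 2 < n" "ij \<in> index_pairs m"
  shows "apply_moves n (commutator n ij) c (top_sticker n ij) = c (side_sticker n ij)"
proof -
  obtain i j where ij: "ij = (i, j)" by (cases ij)
  define t where "t = n - 1"
  \<comment> \<open>The first two facts pin down \<open>n = t + 1\<close> while avoiding truncated
    subtraction. Positivity of the indices keeps \<open>- layer n j\<close> out of the top
    slice.\<close>
  have "t < n" "n \<le> t + 1" "0 < i" "i < j" "2 * j < t"
    using assms by (auto simp: ij t_def index_pairs_def)
  then show ?thesis
    unfolding ij commutator_def top_sticker_def side_sticker_def t_def[symmetric]
    by (simp add: in_slice_iff apply_move_cases del: apply_move.simps)
qed

lemma commutator_other_stickers: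
  assumes "4 * m + 2 < n" "ij \<in> index_pairs m" "kl \<in> index_pairs m" "kl \<noteq> ij"
  shows "apply_moves n (commutator n ij) c (top_sticker n kl) = c (top_sticker n kl)"
    and "apply_moves n (commutator n ij) c (side_sticker n kl) = c (side_sticker n kl)"
proof -
  obtain i j k l where ij: "ij = (i, j)" and kl: "kl = (k, l)" by (cases ij; cases kl)
  define t where "t = n - 1"
  have *: "t < n" "n \<le> t + 1" "0 < i" "0 < k" "i < j" "k < j" "i < l" "k < l" "2 * j < t" "2 * l < t"
    using assms by (auto simp: ij kl t_def index_pairs_def)
  have neq: "k \<noteq> i \<or> l \<noteq> j" using assms(4) by (simp add: ij kl)
  from neq * show "apply_moves n (commutator n ij) c (top_sticker n kl) = c (top_sticker n kl)"
    unfolding ij kl commutator_def top_sticker_def t_def[symmetric]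
    by (cases "k = i"; cases "l = j")
       (simp_all add: in_slice_iff apply_move_cases del: apply_move.simps)
  from neq * show "apply_moves n (commutator n ij) c (side_sticker n kl) = c (side_sticker n kl)"
    unfolding ij kl commutator_def side_sticker_def t_def[symmetric]
    by (cases "k = i"; cases "l = j")
       (simp_all add: in_slice_iff apply_move_cases del: apply_move.simps)
qed

section \<open>Valid configurations with prescribed top patterns\<close>

lemma layer_in_cubie_coords: "i < n \<Longrightarrow> layer n i \<in> cubie_coords n"
  by (auto simp: layer_def cubie_coords_def)

lemma uminus_layer_in_cubie_coords:
  assumes "i < n"
  shows "- layer n i \<in> cubie_coords n"
proof -
  have "- layer n i = layer n (n - 1 - i)"
    using assms by (simp add: layer_def of_nat_diff)
  with assms layer_in_cubie_coords[of "n - 1 - i" n] show ?thesis by simp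
qed

lemma solved_top_sticker:
  assumes "4 * m + 2 < n" "ij \<in> index_pairs m"
  shows "solved n (top_sticker n ij) = Some White"
proof -
  obtain i j where ij: "ij = (i, j)" by (cases ij)
  have less: "i < n" "j < n" using assms by (auto simp: ij index_pairs_def)
  have "top_sticker n ij \<in> stickers n"
    using layer_in_cubie_coords[OF less(1)] uminus_layer_in_cubie_coords[OF less(2)]
    by (simp add: ij top_sticker_def stickers_def Let_def)
  with assms show ?thesis
    by (auto simp: ij top_sticker_def solved_def index_pairs_def layer_def)
qed

lemma solved_side_sticker:
  assumes "4 * m + 2 < n" "ij \<in> index_pairs m"
  shows "solved n (side_sticker n ij) = Some Green"
proof -
  obtain i j where ij: "ij = (i, j)" by (cases ij)
  have less: "i < n" "j < n" using assms by (auto simp: ij index_pairs_def)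
  have "side_sticker n ij \<in> stickers n"
    using layer_in_cubie_coords[OF less(1)] layer_in_cubie_coords[OF less(2)]
    by (simp add: ij side_sticker_def stickers_def Let_def)
  with assms show ?thesis
    by (auto simp: ij side_sticker_def solved_def index_pairs_def layer_def)
qed

lemma valid_apply_moves:
  "valid n c \<Longrightarrow> set ms \<subseteq> basic_moves n \<Longrightarrow> valid n (apply_moves n ms c)"
  unfolding valid_def by (metis apply_moves_append le_sup_iff set_append)

text \<open>The clause on side stickers carries the induction: each pair still to be treated keeps a
  green sticker for its commutator to bring to the top.\<close>

lemma valid_with_pattern:
  assumes m: "4 * m + 2 < n" and "finite F" "F \<subseteq> index_pairs m"
  shows "\<exists>c. valid n c
    \<and> (\<forall>kl\<in>index_pairs m. c (top_sticker n kl) = Some (if kl \<in> F then Green else White))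
    \<and> (\<forall>kl\<in>index_pairs m - F. c (side_sticker n kl) = Some Green)"
  using assms(2,3)
proof (induction F rule: finite_induct)
  case empty
  have "valid n (solved n)"
    unfolding valid_def by (intro exI[of _ "[]"]) simp
  then show ?case
    using solved_top_sticker[OF m] solved_side_sticker[OF m] by auto
next
  case (insert ij F)
  then obtain c where c: "valid n c"
    "\<forall>kl\<in>index_pairs m. c (top_sticker n kl) = Some (if kl \<in> F then Green else White)"
    "\<forall>kl\<in>index_pairs m - F. c (side_sticker n kl) = Some Green"
    by auto
  have ij: "ij \<in> index_pairs m" using insert.prems by simp
  let ?c = "apply_moves n (commutator n ij) c"
  have "valid n ?c"
    using c(1) commutator_basic_moves[OF m ij] by (rule valid_apply_moves)
  moreover have "?c (top_sticker n kl) = Some (if kl \<in> insert ij F then Green else White)"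
    if "kl \<in> index_pairs m" for kl
    using that c(2,3) ij insert.hyps commutator_top_sticker[OF m ij]
      commutator_other_stickers(1)[OF m ij that] by (cases "kl = ij") auto
  moreover have "?c (side_sticker n kl) = Some Green" if "kl \<in> index_pairs m - insert ij F" for kl
    using that c(3) commutator_other_stickers(2)[OF m ij, of kl] by auto
  ultimately show ?case by blast
qed

text \<open>Reading off the green top stickers maps the valid configurations onto all subsets of the
  \<open>m ^ 2\<close> index pairs.\<close>

lemma card_valid_ge:
  assumes m: "4 * m + 2 < n"
  shows "2 ^ (m ^ 2) \<le> card {c. valid n c}"
proof -
  let ?pattern = "\<lambda>c. {kl \<in> index_pairs m. c (top_sticker n kl) = Some Green}"
  have fin: "finite (index_pairs m)" by (simp add: index_pairs_def)
  have "Pow (index_pairs m) \<subseteq> ?pattern ` {c. valid n c}"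
  proof
    fix F assume "F \<in> Pow (index_pairs m)"
    then have F: "F \<subseteq> index_pairs m" by simp
    obtain c where c: "valid n c"
      "\<forall>kl\<in>index_pairs m. c (top_sticker n kl) = Some (if kl \<in> F then Green else White)"
      using valid_with_pattern[OF m finite_subset[OF F fin] F] by blast
    have "?pattern c = F"
      using c(2) F by (auto split: if_splits)
    with c(1) show "F \<in> ?pattern ` {c. valid n c}" by blast
  qed
  then have "card (Pow (index_pairs m)) \<le> card {c. valid n c}"
    using finite_valid by (rule surj_card_le[rotated])
  then show ?thesis
    by (simp add: card_Pow fin) (simp add: index_pairs_def power2_eq_square)
qed

section \<open>The asymptotic bound\<close>

text \<open>Take logarithms in the two bounds on the number of valid configurations. The 128 is 64
  times 2: \<open>n ^ 2\<close> is at most \<open>64 * m ^ 2\<close>, and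
  \<open>ln (6 * n + 1)\<close> at most \<open>2 * ln n\<close>.\<close>

lemma gods_number_lower_bound:
  assumes "n \<ge> 12"
  shows "ln 2 / 128 * (real n ^ 2 / ln (real n)) \<le> real (gods_number n)"
proof -
  \<comment> \<open>The largest \<open>m\<close> with \<open>4 * m + 2 < n\<close>.\<close>
  define m where "m = (n - 3) div 4"
  have m: "4 * m + 2 < n" "n \<le> 8 * m"
    using assms unfolding m_def by linarith+
  have ln_pos: "0 < ln (real n)" using assms by simp
  have "6 * n + 1 \<le> n * n"
    using mult_le_mono1[OF assms, of n] assms by linarith
  then have sq: "real (6 * n + 1) \<le> real n ^ 2"
    by (metis of_nat_le_iff of_nat_power power2_eq_square)
  have "ln (real (6 * n + 1)) \<le> ln (real n ^ 2)"
    using sq by (subst ln_le_cancel_iff) (use assms in auto)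
  also have "\<dots> = 2 * ln (real n)"
    using assms by (simp add: ln_realpow)
  finally have ln_le: "ln (real (6 * n + 1)) \<le> 2 * ln (real n)" .
  have "2 ^ (m ^ 2) \<le> (6 * n + 1) ^ gods_number n"
    using card_valid_ge[OF m(1)] card_valid_le[of n] by linarith
  then have "(2::real) ^ (m ^ 2) \<le> real (6 * n + 1) ^ gods_number n"
    by (metis of_nat_le_iff of_nat_numeral of_nat_power)
  then have "ln ((2::real) ^ (m ^ 2)) \<le> ln (real (6 * n + 1) ^ gods_number n)"
    by (subst ln_le_cancel_iff) auto
  then have "real (m ^ 2) * ln 2 \<le> real (gods_number n) * ln (real (6 * n + 1))"
    by (subst (asm) (1 2) ln_realpow) auto
  also have "\<dots> \<le> real (gods_number n) * (2 * ln (real n))"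
    using ln_le by (intro mult_left_mono) auto
  finally have *: "real m ^ 2 * ln 2 \<le> real (gods_number n) * (2 * ln (real n))" by simp
  have "real n ^ 2 \<le> (8 * real m) ^ 2"
    using m(2) by (intro power_mono) auto
  then have "real n ^ 2 * ln 2 \<le> 64 * (real m ^ 2 * ln 2)"
    by (simp add: power_mult_distrib)
  with * have "ln 2 * real n ^ 2 \<le> real (gods_number n) * (128 * ln (real n))"
    by (simp only: mult.commute mult.left_commute)
  then show ?thesis
    using ln_pos by (simp add: field_simps)
qed

theorem theorem20:
  "(\<lambda>n. real (gods_number n)) \<in> \<Omega>(\<lambda>n. real n ^ 2 / ln (real n))"
proof (rule landau_omega.bigI[of "ln 2 / 128"])
  show "\<forall>\<^sub>F n in sequentially. norm (real (gods_number n))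
      \<ge> ln 2 / 128 * norm (real n ^ 2 / ln (real n))"
    using eventually_ge_at_top[of 12]
  proof eventually_elim
    case (elim n)
    then show ?case
      using gods_number_lower_bound[OF elim] by simp
  qed
qed simp

end
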